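(* Let $c\in\mathbb{C}$ with $|c|=1$, let $E$ be a complex Banach space, let $I=\mathbb{R}$ or $I=[0,\infty)$, let $f:I\to E$, and let $l\in\mathbb{N}$. (a) If $f$ is $c$-almost periodic, then $f$ is $c^{l}$-almost periodic. (b) If $f$ is $c$-uniformly recurrent, then $f$ is $c^{l}$-uniformly recurrent. (c) If $f$ is semi-$c$-periodic, then $f$ is semi-$c^{l}$-periodic.
   Context: $\mathbb{N}=\{1,2,\dots\}$; $\mathbb{S}:=\mathbb{N}$ if $I=[0,\infty)$ and $\mathbb{S}:=\mathbb{Z}$ if $I=\mathbb{R}$. Let $f:I\to E$ be continuous and $|c|=1$. $f$ is $c$-almost periodic if for each $\epsilon>0$ the set of all $\tau>0$ such that $\|f(t+\tau)-cf(t)\|\le\epsilon$ for all $t\in I$ is relatively dense in $[0,\infty)$, i.e. there exists $L>0$ such that every subinterval of $[0,\infty)$ of length $L$ meets this set. $f$ is $c$-uniformly recurrent if there exists a strictly increasing sequence $(\alpha_n)$ of positive reals with $\alpha_n\to+\infty$ and $\lim_{n\to\infty}\sup_{t\in I}\|f(t+\alpha_n)-cf(t)\|=0$. $f$ is semi-$c$-periodic if for every $\varepsilon>0$ there exists $p>0$ such that $\|f(x+mp)-c^{m}f(x)\|\le\varepsilon$ for all $m\in\mathbb{S}$ and all $x\in I$. *)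

theory Defs
  imports "HOL-Analysis.Analysis"
begin

text \<open>
  The library's \<^class>\<open>banach\<close> is the class of real Banach spaces. A complex one carries in addition
  a complex scalar multiplication that extends the real one and for which the norm is homogeneous.
\<close>

class complex_normed_vector = real_normed_vector +
  fixes scaleC :: "complex \<Rightarrow> 'a \<Rightarrow> 'a" (infixr "*\<^sub>C" 75)
  assumes scaleC_add_right: "a *\<^sub>C (x + y) = a *\<^sub>C x + a *\<^sub>C y"
    and scaleC_add_left: "(a + b) *\<^sub>C x = a *\<^sub>C x + b *\<^sub>C x"
    and scaleC_scaleC: "a *\<^sub>C (b *\<^sub>C x) = (a * b) *\<^sub>C x"
    and scaleC_one: "1 *\<^sub>C x = x"
    and scaleR_scaleC: "r *\<^sub>R x = complex_of_real r *\<^sub>C x"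
    and norm_scaleC: "norm (a *\<^sub>C x) = cmod a * norm x"

class complex_banach = complex_normed_vector + banach

lemma vector_space_scaleC:
  "vector_space (scaleC :: complex \<Rightarrow> 'a \<Rightarrow> 'a::complex_normed_vector)"
  by unfold_locales
    (simp_all add: scaleC_add_right scaleC_add_left scaleC_scaleC scaleC_one)

instantiation complex :: complex_banach
begin

definition scaleC_complex :: "complex \<Rightarrow> complex \<Rightarrow> complex" where
  "scaleC_complex a x = a * x"

instance
  by standard (simp_all add: scaleC_complex_def algebra_simps scaleR_conv_of_real norm_mult)

end

text \<open>
  A function on the domain \<open>I\<close> (either \<open>UNIV\<close> or \<open>{0..}\<close>) is represented by a function on all reals,
  of which only the values on \<open>I\<close> are used. Continuity is part of each of the three notions below.
\<close>

definition relatively_dense :: "real set \<Rightarrow> bool" where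
  "relatively_dense A \<longleftrightarrow> (\<exists>L>0. \<forall>a\<ge>0. {a..a + L} \<inter> A \<noteq> {})"

definition c_almost_periodic ::
    "real set \<Rightarrow> complex \<Rightarrow> (real \<Rightarrow> 'a::complex_banach) \<Rightarrow> bool" where
  "c_almost_periodic I c f \<longleftrightarrow>
     continuous_on I f \<and>
     (\<forall>\<epsilon>>0. relatively_dense {\<tau>. \<tau> > 0 \<and> (\<forall>t\<in>I. norm (f (t + \<tau>) - c *\<^sub>C f t) \<le> \<epsilon>)})"

text \<open>
  The supremum is taken in the extended reals, where it is \<open>\<infinity>\<close> for an unbounded difference;
  a real-valued supremum would then have an arbitrary value.
\<close>

definition c_uniformly_recurrent ::
    "real set \<Rightarrow> complex \<Rightarrow> (real \<Rightarrow> 'a::complex_banach) \<Rightarrow> bool" where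
  "c_uniformly_recurrent I c f \<longleftrightarrow>
     continuous_on I f \<and>
     (\<exists>\<alpha> :: nat \<Rightarrow> real. strict_mono \<alpha> \<and> (\<forall>n. \<alpha> n > 0) \<and> filterlim \<alpha> at_top sequentially \<and>
        (\<lambda>n. SUP t\<in>I. ereal (norm (f (t + \<alpha> n) - c *\<^sub>C f t))) \<longlonglongrightarrow> 0)"

text \<open>
  The set of admissible multiples of a semi-period: the positive integers for the half-line,
  so that \<open>x + m p\<close> stays in the domain, and all integers for the real line.
\<close>

definition multiples_for :: "real set \<Rightarrow> int set" where
  "multiples_for I = (if I = {0..} then {1..} else UNIV)"

definition semi_c_periodic ::
    "real set \<Rightarrow> complex \<Rightarrow> (real \<Rightarrow> 'a::complex_banach) \<Rightarrow> bool" where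
  "semi_c_periodic I c f \<longleftrightarrow>
     continuous_on I f \<and>
     (\<forall>\<epsilon>>0. \<exists>p>0. \<forall>m\<in>multiples_for I. \<forall>x\<in>I.
        norm (f (x + of_int m * p) - (c powi m) *\<^sub>C f x) \<le> \<epsilon>)"

end

theory Submission
  imports Defs
begin

text \<open>
  If the translate of \<open>f\<close> by \<open>\<tau>\<close> is within \<open>\<delta>\<close> of \<open>c f\<close> everywhere on the domain, then the translate
  by \<open>l \<tau>\<close> is within \<open>l \<delta>\<close> of \<open>c\<^sup>l f\<close>: of the \<open>l\<close> steps from \<open>t\<close> to \<open>t + l \<tau>\<close> each costs at
  most \<open>\<delta>\<close>, since the error accumulated before is multiplied by \<open>c\<close>, which is isometric. Hence,
  when almost periods and recurrence times are multiplied by \<open>l\<close>, the error grows by the factor \<open>l\<close>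
  only. As \<open>l\<close> is fixed, the factor can be absorbed in \<open>\<epsilon>\<close> or in a limit, and stretching by \<open>l\<close>
  preserves both relative density and divergence to infinity.

  For semi-periodicity no estimate is needed. The definition controls all multiples \<open>m p\<close> at once,
  and the condition on \<open>l p\<close> for \<open>c\<^sup>l\<close> is the condition on \<open>p\<close> for \<open>c\<close>, restricted to the multiples
  of \<open>l\<close>.
\<close>

lemma scaleC_diff_right:
  fixes x y :: "'a::complex_normed_vector"
  shows "a *\<^sub>C (x - y) = a *\<^sub>C x - a *\<^sub>C y"
proof -
  interpret vector_space "scaleC :: complex \<Rightarrow> 'a \<Rightarrow> 'a"
    by (rule vector_space_scaleC)
  show ?thesis
    by (rule scale_right_diff_distrib)
qed

text \<open>
  The error of the step from \<open>t + k \<tau>\<close> to \<open>t + (k + 1) \<tau>\<close> is at most \<open>\<delta>\<close> because the bound is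
  available at every point of \<open>I\<close>. This is why \<open>I\<close> has to be closed under translation by \<open>\<tau>\<close>.
\<close>

lemma norm_translate_power_le:
  fixes f :: "real \<Rightarrow> 'a::complex_normed_vector"
  assumes c: "cmod c \<le> 1"
    and I: "\<And>t. t \<in> I \<Longrightarrow> t + \<tau> \<in> I"
    and bound: "\<And>t. t \<in> I \<Longrightarrow> norm (f (t + \<tau>) - c *\<^sub>C f t) \<le> \<delta>"
    and t: "t \<in> I"
  shows "norm (f (t + real l * \<tau>) - (c ^ l) *\<^sub>C f t) \<le> real l * \<delta>"
proof -
  have "t + real l * \<tau> \<in> I \<and> norm (f (t + real l * \<tau>) - (c ^ l) *\<^sub>C f t) \<le> real l * \<delta>"
  proof (induction l)
    case 0
    then show ?case using t by (simp add: scaleC_one)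
  next
    case (Suc l)
    define s where "s = t + real l * \<tau>"
    have s: "t + real (Suc l) * \<tau> = s + \<tau>"
      by (simp add: s_def algebra_simps)
    have sI: "s \<in> I" and IH: "norm (f s - (c ^ l) *\<^sub>C f t) \<le> real l * \<delta>"
      using Suc by (simp_all add: s_def)
    have "f (s + \<tau>) - (c ^ Suc l) *\<^sub>C f t = (f (s + \<tau>) - c *\<^sub>C f s) + c *\<^sub>C (f s - (c ^ l) *\<^sub>C f t)"
      by (simp add: scaleC_diff_right scaleC_scaleC)
    then have "norm (f (s + \<tau>) - (c ^ Suc l) *\<^sub>C f t)
        \<le> norm (f (s + \<tau>) - c *\<^sub>C f s) + norm (c *\<^sub>C (f s - (c ^ l) *\<^sub>C f t))"
      by (metis norm_triangle_ineq)
    also have "norm (c *\<^sub>C (f s - (c ^ l) *\<^sub>C f t)) \<le> norm (f s - (c ^ l) *\<^sub>C f t)"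
      using c by (simp add: norm_scaleC mult_left_le_one_le)
    finally have "norm (f (s + \<tau>) - (c ^ Suc l) *\<^sub>C f t) \<le> real (Suc l) * \<delta>"
      using bound[OF sI] IH by (simp add: algebra_simps)
    then show ?case
      unfolding s using I[OF sI] by blast
  qed
  then show ?thesis ..
qed

lemma relatively_dense_scale:
  assumes "relatively_dense A" and r: "r > 0"
  shows "relatively_dense ((\<lambda>x. r * x) ` A)"
proof -
  obtain L where "L > 0" and L: "\<And>a. a \<ge> 0 \<Longrightarrow> {a..a + L} \<inter> A \<noteq> {}"
    using assms by (auto simp: relatively_dense_def)
  have "{a..a + r * L} \<inter> (\<lambda>x. r * x) ` A \<noteq> {}" if "a \<ge> 0" for a
  proof -
    obtain x where "x \<in> A" "a / r \<le> x" "x \<le> a / r + L"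
      using L[of "a / r"] \<open>a \<ge> 0\<close> r by auto
    then have "r * x \<in> {a..a + r * L} \<inter> (\<lambda>x. r * x) ` A"
      using r by (auto simp: field_simps)
    then show ?thesis by blast
  qed
  then show ?thesis
    unfolding relatively_dense_def using \<open>L > 0\<close> r
    by (intro exI[of _ "r * L"]) simp
qed

lemma relatively_dense_mono:
  "relatively_dense A \<Longrightarrow> A \<subseteq> B \<Longrightarrow> relatively_dense B"
  unfolding relatively_dense_def by blast

lemma c_almost_periodic_power:
  fixes f :: "real \<Rightarrow> 'a::complex_banach"
  assumes f: "c_almost_periodic I c f" and c: "cmod c \<le> 1" and l: "l \<ge> 1"
    and I: "\<And>t \<tau>. t \<in> I \<Longrightarrow> \<tau> > 0 \<Longrightarrow> t + \<tau> \<in> I"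
  shows "c_almost_periodic I (c ^ l) f"
  unfolding c_almost_periodic_def
proof (intro conjI allI impI)
  show "continuous_on I f"
    using f by (simp add: c_almost_periodic_def)
next
  fix \<epsilon> :: real assume "\<epsilon> > 0"
  define P where "P d e = {\<tau>. \<tau> > 0 \<and> (\<forall>t\<in>I. norm (f (t + \<tau>) - d *\<^sub>C f t) \<le> e)}" for d e
  have "relatively_dense (P c (\<epsilon> / real l))"
    using f \<open>\<epsilon> > 0\<close> l by (simp add: c_almost_periodic_def P_def)
  then have "relatively_dense ((\<lambda>\<tau>. real l * \<tau>) ` P c (\<epsilon> / real l))"
    using l by (intro relatively_dense_scale) simp_all
  moreover have "(\<lambda>\<tau>. real l * \<tau>) ` P c (\<epsilon> / real l) \<subseteq> P (c ^ l) \<epsilon>"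
  proof clarify
    fix \<tau> assume "\<tau> \<in> P c (\<epsilon> / real l)"
    then have "\<tau> > 0" and "\<And>t. t \<in> I \<Longrightarrow> norm (f (t + \<tau>) - c *\<^sub>C f t) \<le> \<epsilon> / real l"
      by (auto simp: P_def)
    then have "norm (f (t + real l * \<tau>) - (c ^ l) *\<^sub>C f t) \<le> real l * (\<epsilon> / real l)"
      if "t \<in> I" for t
      using norm_translate_power_le[of c I \<tau> f "\<epsilon> / real l" t l] c I that by blast
    then show "real l * \<tau> \<in> P (c ^ l) \<epsilon>"
      using \<open>\<tau> > 0\<close> l by (simp add: P_def)
  qed
  ultimately show
    "relatively_dense {\<tau>. \<tau> > 0 \<and> (\<forall>t\<in>I. norm (f (t + \<tau>) - (c ^ l) *\<^sub>C f t) \<le> \<epsilon>)}"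
    unfolding P_def by (rule relatively_dense_mono)
qed

lemma SUP_norm_translate_power_le:
  fixes f :: "real \<Rightarrow> 'a::complex_normed_vector"
  assumes c: "cmod c \<le> 1" and l: "l \<ge> 1"
    and I: "\<And>t. t \<in> I \<Longrightarrow> t + \<tau> \<in> I"
  shows "(SUP t\<in>I. ereal (norm (f (t + real l * \<tau>) - (c ^ l) *\<^sub>C f t)))
    \<le> ereal (real l) * (SUP t\<in>I. ereal (norm (f (t + \<tau>) - c *\<^sub>C f t)))"
    (is "_ \<le> _ * ?S")
proof (rule SUP_least)
  fix t assume t: "t \<in> I"
  have upper: "ereal (norm (f (s + \<tau>) - c *\<^sub>C f s)) \<le> ?S" if "s \<in> I" for s
    using that by (rule SUP_upper)
  show "ereal (norm (f (t + real l * \<tau>) - (c ^ l) *\<^sub>C f t)) \<le> ereal (real l) * ?S"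
  proof (cases "?S")
    case (real \<delta>)
    then have "\<And>s. s \<in> I \<Longrightarrow> norm (f (s + \<tau>) - c *\<^sub>C f s) \<le> \<delta>"
      using upper by simp
    then show ?thesis
      using norm_translate_power_le[of c I \<tau> f \<delta> t l] c I t real by simp
  next
    case PInf
    then show ?thesis using l by simp
  next
    case MInf
    then show ?thesis using upper[OF t] by simp
  qed
qed

lemma c_uniformly_recurrent_power:
  fixes f :: "real \<Rightarrow> 'a::complex_banach"
  assumes f: "c_uniformly_recurrent I c f" and c: "cmod c \<le> 1" and l: "l \<ge> 1"
    and I: "\<And>t \<tau>. t \<in> I \<Longrightarrow> \<tau> > 0 \<Longrightarrow> t + \<tau> \<in> I" and "I \<noteq> {}"
  shows "c_uniformly_recurrent I (c ^ l) f"
proof -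
  define S where "S d \<tau> = (SUP t\<in>I. ereal (norm (f (t + \<tau>) - d *\<^sub>C f t)))" for d \<tau>
  obtain \<alpha> :: "nat \<Rightarrow> real" where cont: "continuous_on I f"
    and \<alpha>: "strict_mono \<alpha>" "\<And>n. \<alpha> n > 0" "filterlim \<alpha> at_top sequentially"
    and lim: "(\<lambda>n. S c (\<alpha> n)) \<longlonglongrightarrow> 0"
    using f unfolding c_uniformly_recurrent_def S_def by blast
  define \<beta> where "\<beta> n = real l * \<alpha> n" for n
  have "strict_mono \<beta>" "\<And>n. \<beta> n > 0"
    using \<alpha>(1,2) l by (simp_all add: \<beta>_def strict_mono_def)
  moreover have "filterlim \<beta> at_top sequentially"
    unfolding \<beta>_def using l
    by (intro filterlim_tendsto_pos_mult_at_top[OF tendsto_const _ \<alpha>(3)]) simp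
  moreover have "(\<lambda>n. S (c ^ l) (\<beta> n)) \<longlonglongrightarrow> 0"
  proof (rule tendsto_sandwich)
    \<comment> \<open>The supremum of the empty set is \<open>-\<infinity>\<close>; the lower bound comes from any one point of \<open>I\<close>.\<close>
    have "0 \<le> S d \<tau>" for d \<tau>
    proof -
      obtain t where "t \<in> I" using \<open>I \<noteq> {}\<close> by blast
      then show ?thesis
        unfolding S_def by (rule SUP_upper2) simp
    qed
    then show "\<forall>\<^sub>F n in sequentially. 0 \<le> S (c ^ l) (\<beta> n)"
      by simp
    show "\<forall>\<^sub>F n in sequentially. S (c ^ l) (\<beta> n) \<le> ereal (real l) * S c (\<alpha> n)"
      unfolding S_def \<beta>_def
      by (intro always_eventually allI SUP_norm_translate_power_le c l I \<alpha>(2))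
    show "(\<lambda>n. ereal (real l) * S c (\<alpha> n)) \<longlonglongrightarrow> 0"
      using tendsto_cmult_ereal[OF _ lim, of "ereal (real l)"] by simp
  qed simp
  ultimately show ?thesis
    unfolding c_uniformly_recurrent_def S_def using cont by blast
qed

lemma semi_c_periodic_power:
  fixes f :: "real \<Rightarrow> 'a::complex_banach"
  assumes f: "semi_c_periodic I c f" and l: "l \<ge> 1"
  shows "semi_c_periodic I (c ^ l) f"
  unfolding semi_c_periodic_def
proof (intro conjI allI impI)
  show "continuous_on I f"
    using f by (simp add: semi_c_periodic_def)
next
  fix \<epsilon> :: real assume "\<epsilon> > 0"
  then obtain p where "p > 0"
    and p: "\<And>m x. m \<in> multiples_for I \<Longrightarrow> x \<in> I \<Longrightarrow>
      norm (f (x + of_int m * p) - (c powi m) *\<^sub>C f x) \<le> \<epsilon>"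
    using f unfolding semi_c_periodic_def by blast
  have "norm (f (x + of_int m * (real l * p)) - ((c ^ l) powi m) *\<^sub>C f x) \<le> \<epsilon>"
    if m: "m \<in> multiples_for I" and x: "x \<in> I" for m x
  proof -
    have "int l * m \<in> multiples_for I"
      using m l mult_mono[of 1 "int l" 1 m]
      by (auto simp: multiples_for_def split: if_splits)
    moreover have "c powi (int l * m) = (c ^ l) powi m"
      by (simp add: power_int_mult)
    ultimately show ?thesis
      using p[of "int l * m" x] x by (simp add: mult_ac)
  qed
  then show "\<exists>q>0. \<forall>m\<in>multiples_for I. \<forall>x\<in>I.
      norm (f (x + of_int m * q) - ((c ^ l) powi m) *\<^sub>C f x) \<le> \<epsilon>"
    using \<open>p > 0\<close> l by (intro exI[of _ "real l * p"]) simp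
qed

theorem proposition2p9:
  fixes c :: complex and I :: "real set" and f :: "real \<Rightarrow> 'a::complex_banach" and l :: nat
  assumes "cmod c = 1"
    and "I = UNIV \<or> I = {0..}"
    and "l \<ge> 1"
  shows "(c_almost_periodic I c f \<longrightarrow> c_almost_periodic I (c ^ l) f) \<and>
         (c_uniformly_recurrent I c f \<longrightarrow> c_uniformly_recurrent I (c ^ l) f) \<and>
         (semi_c_periodic I c f \<longrightarrow> semi_c_periodic I (c ^ l) f)"
proof -
  have I: "t + \<tau> \<in> I" if "t \<in> I" "\<tau> > 0" for t \<tau>
    using assms(2) that by auto
  have "I \<noteq> {}" and c: "cmod c \<le> 1"
    using assms(1,2) by auto
  then show ?thesis
    using c_almost_periodic_power[OF _ c assms(3) I]
      c_uniformly_recurrent_power[OF _ c assms(3) I]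
      semi_c_periodic_power[OF _ assms(3)]
    by blast
qed

end
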